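(* Let $G$ be a connected graph. Then $q(G\vee G)=2$, where $G\vee G$ is the join of two disjoint copies of $G$.
   Context: All graphs are finite and simple. For a graph $G$ with vertex set $\{1,\dots,n\}$, $S(G)$ denotes the set of all real symmetric $n\times n$ matrices $A=[a_{ij}]$ such that for $i\neq j$, $a_{ij}\neq 0$ if and only if $\{i,j\}$ is an edge of $G$ (diagonal entries are arbitrary). For a square matrix $A$, $q(A)$ is the number of distinct eigenvalues of $A$, and $q(G)=\min\{q(A): A\in S(G)\}$. For graphs $G,H$ with disjoint vertex sets, the join $G\vee H$ has vertex set $V(G)\cup V(H)$ and edge set $E(G)\cup E(H)\cup\{\{g,h\}: g\in V(G), h\in V(H)\}$. *)

theory Defs
  imports "HOL-Analysis.Analysis" "Graph_Theory.Graph_Theory"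
begin

text \<open>
  A finite simple graph is a \<^locale>\<open>pair_graph\<close>: each edge \<open>{u, v}\<close> is represented by the
  two arcs \<open>(u, v)\<close> and \<open>(v, u)\<close>. Matrices of a graph are indexed by the elements of the finite
  vertex type, so the notions below are meant for graphs whose vertex set is \<open>UNIV\<close>.
\<close>

definition matrices_of_graph :: "'v::finite pair_pre_digraph \<Rightarrow> (real ^ 'v ^ 'v) set" where
  "matrices_of_graph G =
     {A. transpose A = A \<and> (\<forall>i j. i \<noteq> j \<longrightarrow> (A $ i $ j \<noteq> 0 \<longleftrightarrow> (i, j) \<in> parcs G))}"

definition eigenvalues :: "'a::field ^ 'n::finite ^ 'n \<Rightarrow> 'a set" where
  "eigenvalues A = {c. \<exists>v. v \<noteq> 0 \<and> A *v v = c *s v}"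

text \<open>
  For the real symmetric matrices in \<^const>\<open>matrices_of_graph\<close> all complex eigenvalues are real,
  so nothing is lost by counting eigenvalues in the field of the entries.
\<close>

definition q_matrix :: "'a::field ^ 'n::finite ^ 'n \<Rightarrow> nat" where
  "q_matrix A = card (eigenvalues A)"

text \<open>An infimum of a nonempty set of natural numbers is attained, so this is a minimum.\<close>

definition q_graph :: "'v::finite pair_pre_digraph \<Rightarrow> nat" where
  "q_graph G = Inf (q_matrix ` matrices_of_graph G)"

definition graph_join ::
    "'a pair_pre_digraph \<Rightarrow> 'b pair_pre_digraph \<Rightarrow> ('a + 'b) pair_pre_digraph" where
  "graph_join G H = \<lparr>
     pverts = pverts G <+> pverts H,
     parcs = {(Inl u, Inl v) | u v. (u, v) \<in> parcs G}
           \<union> {(Inr u, Inr v) | u v. (u, v) \<in> parcs H}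
           \<union> {(Inl u, Inr v) | u v. u \<in> pverts G \<and> v \<in> pverts H}
           \<union> {(Inr v, Inl u) | u v. u \<in> pverts G \<and> v \<in> pverts H} \<rparr>"

lemma pair_graph_graph_join:
  assumes "pair_graph G" and "pair_graph H"
  shows "pair_graph (graph_join G H)"
proof -
  interpret G: pair_graph G by fact
  interpret H: pair_graph H by fact
  have sub: "parcs (graph_join G H) \<subseteq> pverts (graph_join G H) \<times> pverts (graph_join G H)"
    by (auto simp: graph_join_def dest: G.in_arcsD1 G.in_arcsD2 H.in_arcsD1 H.in_arcsD2)
  have fin: "finite (pverts (graph_join G H))"
    using G.pair_finite_verts H.pair_finite_verts by (simp add: graph_join_def)
  have symG: "sym (parcs G)" and symH: "sym (parcs H)"
    using G.pair_sym_arcs H.pair_sym_arcs by (simp_all add: symmetric_def)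
  show ?thesis
  proof unfold_locales
    show "finite (parcs (graph_join G H))"
      using sub fin by (meson finite_SigmaI finite_subset)
    show "symmetric (with_proj (graph_join G H))"
      using symG symH by (auto simp: symmetric_def graph_join_def sym_def)
  next
    fix e assume "e \<in> parcs (graph_join G H)"
    then show "fst e \<noteq> snd e"
      by (auto simp: graph_join_def dest: G.no_loops' H.no_loops')
  qed (use sub fin in auto)
qed

lemma matrices_of_graph_nonempty:
  assumes "pair_graph (G :: 'v::finite pair_pre_digraph)"
  shows "matrices_of_graph G \<noteq> {}"
proof -
  interpret pair_graph G by fact
  have "sym (parcs G)" using pair_sym_arcs by (simp add: symmetric_def)
  then have "(\<chi> i j. if (i, j) \<in> parcs G then 1 else 0) \<in> matrices_of_graph G"
    by (auto simp: matrices_of_graph_def transpose_def vec_eq_iff sym_def)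
  then show ?thesis by blast
qed

end

theory Submission
  imports Defs
begin

text \<open>
  If symmetric matrices \<open>A\<close> and \<open>B\<close> commute and \<open>A\<^sup>2 + B\<^sup>2 = I\<close>, then the block matrix with rows
  \<open>(A, B)\<close> and \<open>(B, -A)\<close> is an involution, so its only eigenvalues are \<open>1\<close> and \<open>-1\<close>.
  It belongs to the join of \<open>G\<close> with itself as soon as \<open>A\<close> belongs to \<open>G\<close> and \<open>B\<close> has no zero
  entry. Take for \<open>A\<close> a small multiple of the identity plus the adjacency matrix and put
  \<open>B = I - Y\<close>, where \<open>Y\<close> is the least nonnegative solution of \<open>Y = (A\<^sup>2 + Y\<^sup>2) / 2\<close>. The entries
  of \<open>Y\<close> are positive along the arcs of \<open>G\<close>, because \<open>Y \<ge> A\<^sup>2 / 2\<close>, and positivity is transitive,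
  because \<open>Y \<ge> Y\<^sup>2 / 2\<close>; as \<open>G\<close> is connected, all entries of \<open>Y\<close> are positive.
  Conversely, the extreme values of the Rayleigh quotient of a symmetric matrix are eigenvalues,
  and they differ unless the matrix is scalar.
\<close>

section \<open>Eigenvalues of real symmetric matrices\<close>

lemma inner_matrix_symmetric:
  fixes A :: "real ^ 'n::finite ^ 'n"
  assumes "transpose A = A"
  shows "x \<bullet> (A *v y) = (A *v x) \<bullet> y"
  using assms by (metis dot_lmul_matrix vector_transpose_matrix)

text \<open>Eigenvectors for distinct eigenvalues are orthogonal, hence independent. Finiteness
  matters because \<open>card\<close> of an infinite set is 0, which would ruin a lower bound on
  \<open>q_matrix\<close>.\<close>

lemma finite_eigenvalues_symmetric:
  fixes A :: "real ^ 'n::finite ^ 'n"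
  assumes "transpose A = A"
  shows "finite (eigenvalues A)"
proof -
  have "\<forall>c\<in>eigenvalues A. \<exists>v. v \<noteq> 0 \<and> A *v v = c *s v"
    by (simp add: eigenvalues_def)
  then obtain f where f: "\<And>c. c \<in> eigenvalues A \<Longrightarrow> f c \<noteq> 0 \<and> A *v f c = c *s f c"
    using bchoice[of "eigenvalues A" "\<lambda>c v. v \<noteq> 0 \<and> A *v v = c *s v"] by blast
  have orth: "f c \<bullet> f d = 0" if "c \<in> eigenvalues A" "d \<in> eigenvalues A" "c \<noteq> d" for c d
  proof -
    have "d * (f c \<bullet> f d) = c * (f c \<bullet> f d)"
      using inner_matrix_symmetric[OF assms, of "f c" "f d"] f that
      by (simp add: scalar_mult_eq_scaleR)
    then show ?thesis using that by simp
  qed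
  have inj: "inj_on f (eigenvalues A)"
    by (metis f inj_onI inner_eq_zero_iff orth)
  have "pairwise orthogonal (f ` eigenvalues A)"
    unfolding pairwise_def orthogonal_def using orth by fastforce
  moreover have "0 \<notin> f ` eigenvalues A" using f by force
  ultimately have "independent (f ` eigenvalues A)"
    by (rule pairwise_orthogonal_independent)
  then show ?thesis
    using inj finite_image_iff independent_imp_finite by blast
qed

text \<open>Otherwise the quadratic form, moved from \<open>v\<close> in the direction
  \<open>N *v v\<close>, has derivative \<open>2 * a > 0\<close> at \<open>v\<close>, so a small
  step backwards would make it negative.\<close>

lemma positive_semidefinite_null_vector:
  fixes N :: "real ^ 'n::finite ^ 'n"
  assumes sym: "transpose N = N" and psd: "\<And>x. 0 \<le> x \<bullet> (N *v x)" and v: "v \<bullet> (N *v v) = 0"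
  shows "N *v v = 0"
proof (rule ccontr)
  assume nz: "N *v v \<noteq> 0"
  define w where "w = N *v v"
  define a where "a = w \<bullet> w"
  define b where "b = w \<bullet> (N *v w)"
  have a: "a > 0" using nz by (simp add: a_def w_def)
  have b: "b \<ge> 0" unfolding b_def by (rule psd)
  have vw: "v \<bullet> (N *v w) = a"
    by (simp add: inner_matrix_symmetric[OF sym] a_def flip: w_def)
  have q: "0 \<le> 2 * t * a + t\<^sup>2 * b" for t
  proof -
    have "(v + t *\<^sub>R w) \<bullet> (N *v (v + t *\<^sub>R w)) = 2 * t * a + t\<^sup>2 * b"
      using v vw by (simp add: algebra_simps inner_simps matrix_vector_mult_add_rdistrib
          matrix_vector_right_distrib matrix_vector_mult_scaleR power2_eq_square a_def b_def
          flip: w_def)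
    then show ?thesis using psd[of "v + t *\<^sub>R w"] by simp
  qed
  \<comment> \<open>The minimiser would be \<open>- a / b\<close>; the denominator
    \<open>b + 1\<close> also covers \<open>b = 0\<close>.\<close>
  have "2 * (- (a / (b + 1))) * a + (- (a / (b + 1)))\<^sup>2 * b
      = - (a\<^sup>2 * (b + 2)) / (b + 1)\<^sup>2"
  proof -
    have "b + 1 \<noteq> 0" using b by linarith
    then show ?thesis by (simp add: divide_simps power2_eq_square) (simp add: algebra_simps)
  qed
  also have "\<dots> < 0" using a b by (simp add: divide_neg_pos)
  finally show False using q[of "- (a / (b + 1))"] by linarith
qed

text \<open>Compactness gives a maximiser \<open>v\<close> of the form on the unit sphere, with
  value \<open>c\<close>. Then \<open>c\<close> times the identity minus \<open>A\<close> is
  positive semidefinite and its form vanishes at \<open>v\<close>, so \<open>v\<close> is an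
  eigenvector.\<close>

lemma max_eigenvalue_symmetric:
  fixes A :: "real ^ 'n::finite ^ 'n"
  assumes "transpose A = A"
  obtains c where "c \<in> eigenvalues A" "\<And>x. x \<bullet> (A *v x) \<le> c * (x \<bullet> x)"
proof -
  let ?f = "\<lambda>x. x \<bullet> (A *v x)"
  have "compact (sphere (0 :: real ^ 'n) 1)" by simp
  moreover have "sphere (0 :: real ^ 'n) 1 \<noteq> {}" by simp
  moreover have "continuous_on (sphere 0 1) ?f" by (intro continuous_intros)
  ultimately obtain v where v: "v \<in> sphere 0 1" and max: "\<And>x. x \<in> sphere 0 1 \<Longrightarrow> ?f x \<le> ?f v"
    using continuous_attains_sup[of "sphere 0 1" ?f] by blast
  define c where "c = ?f v"
  have le: "?f x \<le> c * (x \<bullet> x)" for x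
  proof (cases "x = 0")
    case False
    have "x = norm x *\<^sub>R sgn x" by (simp add: sgn_div_norm False)
    then have "?f x = (norm x)\<^sup>2 * ?f (sgn x)"
      by (metis (no_types, lifting) inner_scaleR_left inner_scaleR_right matrix_vector_mult_scaleR
          mult.assoc power2_eq_square)
    also have "\<dots> \<le> (norm x)\<^sup>2 * c"
      unfolding c_def by (intro mult_left_mono max) (auto simp: False norm_sgn)
    finally show ?thesis by (simp add: power2_norm_eq_inner mult.commute)
  qed simp
  have vv: "v \<bullet> v = 1" using v by (simp add: dot_square_norm)
  define N where "N = c *\<^sub>R mat 1 - A"
  have N: "N *v x = c *\<^sub>R x - A *v x" for x
    by (simp add: N_def matrix_vector_mult_diff_rdistrib flip: scaleR_matrix_vector_assoc)
  have "N *v v = 0"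
  proof (rule positive_semidefinite_null_vector)
    show "transpose N = N"
      using assms by (simp add: N_def transpose_def vec_eq_iff mat_def)
    show "0 \<le> x \<bullet> (N *v x)" for x using le[of x] by (simp add: N inner_diff_right)
    show "v \<bullet> (N *v v) = 0" using vv by (simp add: N inner_diff_right c_def)
  qed
  then have "A *v v = c *s v" by (simp add: N scalar_mult_eq_scaleR)
  moreover have "v \<noteq> 0" using vv by auto
  ultimately have "c \<in> eigenvalues A" by (auto simp: eigenvalues_def)
  then show thesis using that le by blast
qed

text \<open>Applied to \<open>A\<close> and \<open>- A\<close>, the previous lemma yields the
  largest eigenvalue \<open>c\<close> and the smallest \<open>- d\<close>. If they agree, the form
  is \<open>c * (x \<bullet> x)\<close>, and polarisation at two basis vectors makes every
  off-diagonal entry zero.\<close>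

lemma two_eigenvalues_symmetric:
  fixes A :: "real ^ 'n::finite ^ 'n"
  assumes sym: "transpose A = A" and "i \<noteq> j" and nz: "A $ i $ j \<noteq> 0"
  shows "2 \<le> q_matrix A"
proof -
  obtain c where c: "c \<in> eigenvalues A" "\<And>x. x \<bullet> (A *v x) \<le> c * (x \<bullet> x)"
    using max_eigenvalue_symmetric[OF sym] by blast
  have "transpose (- A) = - A" using sym by (simp add: transpose_def vec_eq_iff)
  then obtain d where d: "d \<in> eigenvalues (- A)" "\<And>x. x \<bullet> ((- A) *v x) \<le> d * (x \<bullet> x)"
    using max_eigenvalue_symmetric by blast
  have minus: "(- A) *v x = - (A *v x)" for x
    by (simp add: matrix_vector_mult_def vec_eq_iff sum_negf)
  have d': "- d \<in> eigenvalues A"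
  proof -
    obtain v where v: "v \<noteq> 0" "- (A *v v) = d *\<^sub>R v"
      using d(1) by (auto simp: eigenvalues_def minus scalar_mult_eq_scaleR)
    from v(2) have "A *v v = (- d) *s v"
      by (metis minus_minus scaleR_minus_left scalar_mult_eq_scaleR)
    with v(1) show ?thesis unfolding eigenvalues_def by blast
  qed
  have "c \<noteq> - d"
  proof
    assume "c = - d"
    then have quad: "x \<bullet> (A *v x) = c * (x \<bullet> x)" for x
      using c(2)[of x] d(2)[of x] by (simp add: minus)
    let ?i = "axis i (1::real)" and ?j = "axis j (1::real)"
    have entry: "axis k 1 \<bullet> (A *v axis l 1) = A $ k $ l" for k l
      by (simp add: inner_axis' matrix_vector_mul_component inner_axis)
    have "A $ j $ i = A $ i $ j" using sym by (metis transpose_def vec_lambda_beta)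
    moreover have "?i \<bullet> ?j = 0" using \<open>i \<noteq> j\<close> by (simp add: inner_axis_axis)
    moreover have "A $ i $ j + A $ j $ i = c * (2 * (?i \<bullet> ?j))"
      using quad[of "?i + ?j"] quad[of ?i] quad[of ?j]
      by (simp add: matrix_vector_right_distrib inner_add_left inner_add_right entry
          inner_commute algebra_simps)
    ultimately show False using nz by simp
  qed
  then have "card {c, - d} = 2" by simp
  moreover have "card {c, - d} \<le> card (eigenvalues A)"
    using c d' finite_eigenvalues_symmetric[OF sym] by (intro card_mono) auto
  ultimately show ?thesis by (simp add: q_matrix_def)
qed

lemma q_matrix_involution:
  fixes M :: "real ^ 'n::finite ^ 'n"
  assumes sq: "M ** M = mat 1" and "i \<noteq> j" and nz: "M $ i $ j \<noteq> 0"
  shows "q_matrix M = 2"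
proof -
  have MM: "M *v (M *v x) = x" for x
    by (simp add: matrix_vector_mul_assoc sq)
  have sub: "eigenvalues M \<subseteq> {1, -1}"
  proof
    fix c assume "c \<in> eigenvalues M"
    then obtain v where v: "v \<noteq> 0" "M *v v = c *\<^sub>R v"
      by (auto simp: eigenvalues_def scalar_mult_eq_scaleR)
    have "v = (c * c) *\<^sub>R v" using MM[of v] v by (simp add: matrix_vector_mult_scaleR)
    then have "c * c = 1" using v(1) by (metis scaleR_cancel_right scaleR_one)
    then show "c \<in> {1, -1}" by (simp add: square_eq_1_iff)
  qed
  have ev: "s \<in> eigenvalues M" if s: "s * s = 1" for s
  proof -
    \<comment> \<open>\<open>M\<close> swaps \<open>axis j 1\<close> and its image, so for
      \<open>s * s = 1\<close> it multiplies \<open>?v\<close> by \<open>s\<close>. As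
      \<open>i\<close> differs from \<open>j\<close>, coordinate \<open>i\<close> of
      \<open>?v\<close> is the nonzero entry \<open>M $ i $ j\<close>.\<close>
    let ?v = "axis j s + M *v axis j 1"
    have "(M *v axis j 1) $ i = M $ i $ j"
      by (simp add: matrix_vector_mul_component inner_axis)
    then have "?v $ i \<noteq> 0" using assms by (simp add: axis_def)
    then have "?v \<noteq> 0" by (metis zero_index)
    moreover have ax: "axis j s = s *\<^sub>R axis j 1" by (simp add: axis_def vec_eq_iff)
    have "M *v ?v = s *s ?v"
      unfolding ax using s
      by (simp add: matrix_vector_right_distrib MM matrix_vector_mult_scaleR
          scalar_mult_eq_scaleR scaleR_add_right)
    ultimately show ?thesis unfolding eigenvalues_def by blast
  qed
  have "eigenvalues M = {1, -1}" using sub ev[of 1] ev[of "-1"] by auto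
  then show ?thesis by (simp add: q_matrix_def)
qed

section \<open>Square roots of nonnegative perturbations of the identity\<close>

lemma
  fixes A B C :: "real ^ 'n::finite ^ 'n"
  shows matrix_add_rdistrib: "(A + B) ** C = A ** C + B ** C"
    and matrix_diff_ldistrib: "A ** (B - C) = A ** B - A ** C"
    and matrix_diff_rdistrib: "(A - B) ** C = A ** C - B ** C"
  by (simp_all add: matrix_matrix_mult_def vec_eq_iff algebra_simps sum.distrib sum_subtractf)

lemma tendsto_matrix_mult:
  fixes X :: "nat \<Rightarrow> real ^ 'n::finite ^ 'm::finite" and Y :: "nat \<Rightarrow> real ^ 'k::finite ^ 'n"
  assumes "X \<longlonglongrightarrow> A" "Y \<longlonglongrightarrow> B"
  shows "(\<lambda>n. X n ** Y n) \<longlonglongrightarrow> A ** B"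
  unfolding matrix_matrix_mult_def
  by (intro vec_tendstoI; simp; intro tendsto_sum tendsto_mult tendsto_vec_nth assms)

text \<open>Exchanging the sums weights the row sums of \<open>Y\<close> by the nonnegative entries
  of \<open>X\<close>. This keeps the iteration below bounded.\<close>

lemma row_sum_matrix_mult_le:
  fixes X Y :: "real ^ 'n::finite ^ 'n"
  assumes X: "\<And>i j. 0 \<le> X $ i $ j" "\<And>i. (\<Sum>j\<in>UNIV. X $ i $ j) \<le> r"
    and Y: "\<And>i. (\<Sum>j\<in>UNIV. Y $ i $ j) \<le> s" and "0 \<le> s"
  shows "(\<Sum>j\<in>UNIV. (X ** Y) $ i $ j) \<le> r * s"
proof -
  have "(\<Sum>j\<in>UNIV. (X ** Y) $ i $ j) = (\<Sum>k\<in>UNIV. X $ i $ k * (\<Sum>j\<in>UNIV. Y $ k $ j))"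
    by (simp add: matrix_matrix_mult_def sum_distrib_left) (rule sum.swap)
  also have "\<dots> \<le> (\<Sum>k\<in>UNIV. X $ i $ k * s)"
    by (intro sum_mono mult_left_mono X Y)
  also have "\<dots> = (\<Sum>k\<in>UNIV. X $ i $ k) * s" by (simp add: sum_distrib_right)
  also have "\<dots> \<le> r * s" by (intro mult_right_mono X assms)
  finally show ?thesis .
qed

text \<open>Fixed-point iteration for \<open>1 - sqrt (1 - S)\<close>. Its iterates are polynomials
  in \<open>S\<close>, so they inherit symmetry and commute with whatever commutes with
  \<open>S\<close>; starting at 0 makes them increase entrywise when \<open>S\<close> is
  nonnegative.\<close>

primrec sqrt_iter :: "real ^ 'n::finite ^ 'n \<Rightarrow> nat \<Rightarrow> real ^ 'n ^ 'n" where
  "sqrt_iter S 0 = 0"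
| "sqrt_iter S (Suc n) = (1/2) *\<^sub>R (S + sqrt_iter S n ** sqrt_iter S n)"

lemma transpose_sqrt_iter:
  assumes "transpose S = S"
  shows "transpose (sqrt_iter S n) = sqrt_iter S n"
proof (induction n)
  case (Suc n)
  have "transpose ((1/2) *\<^sub>R (S + X ** X)) = (1/2) *\<^sub>R (transpose S + transpose X ** transpose X)"
    for X by (simp add: vec_eq_iff transpose_def matrix_matrix_mult_def mult.commute)
  then show ?case using assms Suc by simp
qed (simp add: transpose_def vec_eq_iff)

lemma sqrt_iter_commute:
  assumes "A ** S = S ** A"
  shows "A ** sqrt_iter S n = sqrt_iter S n ** A"
proof (induction n)
  case (Suc n)
  let ?Y = "sqrt_iter S n"
  have "A ** (?Y ** ?Y) = (?Y ** ?Y) ** A"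
    by (metis Suc matrix_mul_assoc)
  then show ?case
    using assms by (simp add: matrix_add_ldistrib matrix_add_rdistrib matrix_scalar_ac
        scaleR_add_right flip: scalar_matrix_assoc)
qed (simp add: matrix_matrix_mult_def vec_eq_iff)

text \<open>
  The equation for \<open>Y\<close> says \<open>(I - Y)\<^sup>2 = I - S\<close>. The iteration converges because it is monotone
  in every entry and preserves the row-sum bound \<open>1/2\<close>.
\<close>

lemma nonneg_sqrt_defect:
  fixes S :: "real ^ 'n::finite ^ 'n"
  assumes S0: "\<And>i j. 0 \<le> S $ i $ j" and S1: "\<And>i. (\<Sum>j\<in>UNIV. S $ i $ j) \<le> 3/4"
    and sym: "transpose S = S"
  obtains Y where "Y = (1/2) *\<^sub>R (S + Y ** Y)" "\<And>i j. 0 \<le> Y $ i $ j" "\<And>i j. Y $ i $ j \<le> 1/2"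
    "transpose Y = Y" "\<And>A. A ** S = S ** A \<Longrightarrow> A ** Y = Y ** A"
proof -
  let ?Y = "sqrt_iter S"
  have nonneg: "0 \<le> ?Y n $ i $ j" for n i j
    by (induction n arbitrary: i j)
      (auto simp: S0 matrix_matrix_mult_def intro!: sum_nonneg add_nonneg_nonneg)
  have mono: "?Y n $ i $ j \<le> ?Y (Suc n) $ i $ j" for n i j
  proof (induction n arbitrary: i j)
    case 0
    show ?case using nonneg[of "Suc 0"] by simp
  next
    case (Suc n)
    have "(?Y n ** ?Y n) $ i $ j \<le> (?Y (Suc n) ** ?Y (Suc n)) $ i $ j"
      unfolding matrix_matrix_mult_def vec_lambda_beta
      by (intro sum_mono mult_mono Suc nonneg)
    then show ?case by (subst (1 2) sqrt_iter.simps(2)) simp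
  qed
  \<comment> \<open>The two bounds fit together:
    \<open>(3/4 + (1/2) * (1/2)) / 2 = 1/2\<close>.\<close>
  have rows: "(\<Sum>j\<in>UNIV. ?Y n $ i $ j) \<le> 1/2" for n i
  proof (induction n arbitrary: i)
    case (Suc n)
    have "(\<Sum>j\<in>UNIV. (?Y n ** ?Y n) $ i $ j) \<le> 1/2 * (1/2)"
      by (rule row_sum_matrix_mult_le) (use nonneg Suc in auto)
    moreover have "(\<Sum>j\<in>UNIV. ?Y (Suc n) $ i $ j)
        = (1/2) * ((\<Sum>j\<in>UNIV. S $ i $ j) + (\<Sum>j\<in>UNIV. (?Y n ** ?Y n) $ i $ j))"
      by (simp add: sum.distrib sum_divide_distrib[symmetric])
    ultimately show ?case using S1[of i] by simp
  qed simp
  have entries: "?Y n $ i $ j \<le> 1/2" for n i j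
  proof -
    have "?Y n $ i $ j \<le> (\<Sum>j\<in>UNIV. ?Y n $ i $ j)"
      by (rule member_le_sum) (auto simp: nonneg)
    then show ?thesis using rows[of n i] by linarith
  qed
  have "\<exists>L. (\<lambda>n. ?Y n $ i $ j) \<longlonglongrightarrow> L" for i j
    using incseq_convergent[of "\<lambda>n. ?Y n $ i $ j" "1/2"] mono entries
    by (metis incseq_SucI)
  then obtain L where L: "\<And>i j. (\<lambda>n. ?Y n $ i $ j) \<longlonglongrightarrow> L i j" by metis
  define Y where "Y = (\<chi> i j. L i j)"
  have lim: "?Y \<longlonglongrightarrow> Y" by (intro vec_tendstoI) (simp add: Y_def L)
  have "(\<lambda>n. ?Y (Suc n)) \<longlonglongrightarrow> (1/2) *\<^sub>R (S + Y ** Y)"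
    by (simp only: sqrt_iter.simps) (intro tendsto_intros tendsto_matrix_mult lim)
  then have 1: "Y = (1/2) *\<^sub>R (S + Y ** Y)"
    using LIMSEQ_Suc[OF lim] LIMSEQ_unique by blast
  have 2: "0 \<le> Y $ i $ j" for i j
    using L[of i j] nonneg by (auto simp: Y_def intro: LIMSEQ_le_const)
  have 3: "Y $ i $ j \<le> 1/2" for i j
    unfolding Y_def vec_lambda_beta using L[of i j] by (rule LIMSEQ_le_const2) (use entries in blast)
  have "Y $ i $ j = Y $ j $ i" for i j
  proof -
    have "?Y n $ i $ j = ?Y n $ j $ i" for n
      using transpose_sqrt_iter[OF sym, of n] by (simp add: transpose_def vec_eq_iff)
    then have "(\<lambda>n. ?Y n $ j $ i) \<longlonglongrightarrow> L i j" using L[of i j] by simp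
    then have "L i j = L j i" using L[of j i] by (rule LIMSEQ_unique)
    then show ?thesis by (simp add: Y_def)
  qed
  then have 4: "transpose Y = Y" by (simp add: transpose_def vec_eq_iff)
  have 5: "A ** Y = Y ** A" if A: "A ** S = S ** A" for A
  proof -
    have "(\<lambda>n. A ** ?Y n) \<longlonglongrightarrow> A ** Y" "(\<lambda>n. ?Y n ** A) \<longlonglongrightarrow> Y ** A"
      by (intro tendsto_matrix_mult lim tendsto_const)+
    then show ?thesis using sqrt_iter_commute[OF A] LIMSEQ_unique by simp
  qed
  from 1 2 3 4 5 show thesis by (rule that)
qed

section \<open>The join of a connected graph with itself\<close>

definition reflection_matrix :: "real ^ 'n ^ 'n \<Rightarrow> real ^ 'n ^ 'n \<Rightarrow> real ^ ('n + 'n) ^ ('n + 'n)"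
  where "reflection_matrix A B = (\<chi> i j. case i of
      Inl k \<Rightarrow> (case j of Inl l \<Rightarrow> A $ k $ l | Inr l \<Rightarrow> B $ k $ l)
    | Inr k \<Rightarrow> (case j of Inl l \<Rightarrow> B $ k $ l | Inr l \<Rightarrow> - A $ k $ l))"

text \<open>The diagonal blocks of the square are \<open>A ** A + B ** B\<close>; the minus sign in
  the last block makes the other two the commutator of \<open>A\<close> and \<open>B\<close>, up to
  sign.\<close>

lemma reflection_matrix_involution:
  fixes A B :: "real ^ 'n::finite ^ 'n"
  assumes comm: "A ** B = B ** A" and sq: "A ** A + B ** B = mat 1"
  shows "reflection_matrix A B ** reflection_matrix A B = mat 1"
proof -
  have split: "sum f (UNIV :: ('n + 'n) set) = (\<Sum>k\<in>UNIV. f (Inl k)) + (\<Sum>k\<in>UNIV. f (Inr k))"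
    for f :: "'n + 'n \<Rightarrow> real"
    by (simp add: sum.Plus[of UNIV UNIV, simplified] comp_def)
  have c: "(\<Sum>m\<in>UNIV. A $ k $ m * B $ m $ l) = (\<Sum>m\<in>UNIV. B $ k $ m * A $ m $ l)" for k l
    using comm by (simp add: vec_eq_iff matrix_matrix_mult_def)
  have s: "(\<Sum>m\<in>UNIV. A $ k $ m * A $ m $ l) + (\<Sum>m\<in>UNIV. B $ k $ m * B $ m $ l)
      = (if k = l then 1 else 0)" for k l
    using sq by (simp add: vec_eq_iff matrix_matrix_mult_def mat_def)
  show ?thesis
    unfolding vec_eq_iff
  proof (intro allI)
    fix i j
    show "(reflection_matrix A B ** reflection_matrix A B) $ i $ j = mat 1 $ i $ j"
      by (cases i; cases j)
        (simp_all add: matrix_matrix_mult_def reflection_matrix_def split mat_def c s sum_negf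
          add.commute)
  qed
qed

text \<open>Connectedness is defined as strong connectedness of the symmetric closure, which has the
  same reachability relation here because the arcs of a \<open>pair_graph\<close> are already
  symmetric.\<close>

lemma connected_arcs_rtrancl:
  assumes "pair_graph G" and "Digraph_Component.connected (with_proj G)"
    and "u \<in> pverts G" "v \<in> pverts G"
  shows "(u, v) \<in> (parcs G)\<^sup>*"
proof -
  interpret pair_graph G by fact
  have "u \<rightarrow>\<^sup>*\<^bsub>with_proj (mk_symmetric (with_proj G))\<^esub> v"
    using assms by (auto simp: Digraph_Component.connected_def strongly_connected_def)
  then have "u \<rightarrow>\<^sup>*\<^bsub>with_proj G\<^esub> v"
    using reachable_mk_symmetric_eq[OF pair_sym_arcs] by simp
  then show ?thesis
    by (auto simp: reachable_def dest: rtrancl_on_rtranclI)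
qed

lemma commuting_pair_of_connected_graph:
  fixes G :: "'v::finite pair_pre_digraph"
  assumes G: "pair_graph G" "pverts G = UNIV" "Digraph_Component.connected (with_proj G)"
  obtains A B :: "real ^ 'v ^ 'v" where "A \<in> matrices_of_graph G" "transpose B = B"
    "\<And>i j. B $ i $ j \<noteq> 0" "A ** B = B ** A" "A ** A + B ** B = mat 1"
proof -
  interpret pair_graph G by fact
  have symG: "(i, j) \<in> parcs G \<longleftrightarrow> (j, i) \<in> parcs G" for i j
    using pair_sym_arcs by (auto simp: symmetric_def sym_def)
  \<comment> \<open>With this \<open>t\<close> the row sums of \<open>A\<close> are at most 1/2, so
    those of \<open>A ** A\<close> are at most 1/4, within the required 3/4.\<close>
  define t :: real where "t = 1 / (2 * real CARD('v))"
  have t: "t > 0" by (simp add: t_def)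
  \<comment> \<open>The positive diagonal makes \<open>A $ i $ i * A $ i $ j\<close> a positive term
    of \<open>(A ** A) $ i $ j\<close> for every arc \<open>(i, j)\<close>.\<close>
  define A :: "real ^ 'v ^ 'v" where
    "A = (\<chi> i j. if i = j \<or> (i, j) \<in> parcs G then t else 0)"
  have A_nonneg: "0 \<le> A $ i $ j" for i j using t by (simp add: A_def)
  have symA: "transpose A = A"
    using symG by (auto simp: A_def transpose_def vec_eq_iff)
  have AG: "A \<in> matrices_of_graph G"
    using symA t by (auto simp: matrices_of_graph_def A_def)
  have "(\<Sum>j\<in>UNIV. A $ i $ j) \<le> (\<Sum>j\<in>(UNIV :: 'v set). t)" for i
    using t by (intro sum_mono) (simp add: A_def)
  then have A_rows: "(\<Sum>j\<in>UNIV. A $ i $ j) \<le> 1/2" for i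
    by (simp add: t_def)
  define S where "S = A ** A"
  have S0: "0 \<le> S $ i $ j" for i j
    by (auto simp: S_def matrix_matrix_mult_def A_nonneg intro!: sum_nonneg)
  have S1: "(\<Sum>j\<in>UNIV. S $ i $ j) \<le> 3/4" for i
    using row_sum_matrix_mult_le[OF A_nonneg A_rows A_rows, of i] by (simp add: S_def)
  have S_sym: "transpose S = S" by (simp add: S_def matrix_transpose_mul symA)
  obtain Y where Y: "Y = (1/2) *\<^sub>R (S + Y ** Y)" and Y0: "\<And>i j. 0 \<le> Y $ i $ j"
    and Y1: "\<And>i j. Y $ i $ j \<le> 1/2" and Ysym: "transpose Y = Y"
    and Ycomm: "\<And>A. A ** S = S ** A \<Longrightarrow> A ** Y = Y ** A"
    using nonneg_sqrt_defect[OF S0 S1 S_sym] by blast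
  have Yij: "Y $ i $ j = (S $ i $ j + (\<Sum>k\<in>UNIV. Y $ i $ k * Y $ k $ j)) / 2" for i j
    by (subst Y) (simp add: matrix_matrix_mult_def)
  have arc_pos: "0 < Y $ i $ j" if "i = j \<or> (i, j) \<in> parcs G" for i j
  proof -
    have "A $ i $ i * A $ i $ j \<le> (\<Sum>k\<in>UNIV. A $ i $ k * A $ k $ j)"
      by (rule member_le_sum) (auto simp: A_nonneg)
    moreover have "0 < A $ i $ i * A $ i $ j" using that t by (auto simp: A_def)
    ultimately have "0 < S $ i $ j" by (simp add: S_def matrix_matrix_mult_def)
    moreover have "0 \<le> (\<Sum>k\<in>UNIV. Y $ i $ k * Y $ k $ j)"
      by (intro sum_nonneg mult_nonneg_nonneg Y0)
    ultimately show ?thesis by (subst Yij) simp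
  qed
  have trans: "0 < Y $ i $ j" if "0 < Y $ i $ k" "0 < Y $ k $ j" for i j k
  proof -
    have "Y $ i $ k * Y $ k $ j \<le> (\<Sum>k\<in>UNIV. Y $ i $ k * Y $ k $ j)"
      by (rule member_le_sum) (auto simp: Y0)
    moreover have "0 < Y $ i $ k * Y $ k $ j" using that by simp
    ultimately show ?thesis using S0[of i j] by (subst Yij) simp
  qed
  have pos: "0 < Y $ i $ j" for i j
  proof -
    have "(i, j) \<in> (parcs G)\<^sup>*" using connected_arcs_rtrancl[OF G(1,3)] G(2) by simp
    then show ?thesis
    proof (induction rule: rtrancl_induct)
      case base
      show ?case using arc_pos by simp
    next
      case (step j k)
      then show ?case using trans arc_pos by metis
    qed
  qed
  define B where "B = mat 1 - Y"
  have "transpose B = B"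
    using Ysym by (simp add: B_def transpose_def vec_eq_iff mat_def)
  \<comment> \<open>Off the diagonal the entry is \<open>- Y $ i $ j < 0\<close>; on the diagonal it
    is at least 1/2.\<close>
  moreover have "B $ i $ j \<noteq> 0" for i j
    using pos[of i j] Y1[of i j] by (auto simp: B_def mat_def)
  moreover have "A ** B = B ** A"
    using Ycomm[of A]
    by (simp add: B_def S_def matrix_mul_assoc matrix_diff_ldistrib matrix_diff_rdistrib)
  moreover have "A ** A + B ** B = mat 1"
  proof -
    have "B ** B = mat 1 - 2 *\<^sub>R Y + Y ** Y"
      by (simp add: B_def matrix_diff_ldistrib matrix_diff_rdistrib scaleR_2)
    \<comment> \<open>The fixed-point equation cancels \<open>Y ** Y\<close>, leaving
      \<open>B ** B = mat 1 - S\<close>.\<close>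
    moreover have "2 *\<^sub>R Y = S + Y ** Y" by (subst Y) simp
    ultimately show ?thesis by (simp add: S_def)
  qed
  ultimately show thesis using that AG by blast
qed

theorem theorem5p2:
  fixes G :: "'v::finite pair_pre_digraph"
  assumes "pair_graph G"
    and "pverts G = UNIV"
    and "Digraph_Component.connected (with_proj G)"
  shows "q_graph (graph_join G G) = 2"
proof -
  obtain A B :: "real ^ 'v ^ 'v" where A: "A \<in> matrices_of_graph G" and Bsym: "transpose B = B"
    and Bnz: "\<And>i j. B $ i $ j \<noteq> 0" and AB: "A ** B = B ** A" "A ** A + B ** B = mat 1"
    using commuting_pair_of_connected_graph[OF assms] by blast
  let ?M = "reflection_matrix A B"
  have "A $ i $ j = A $ j $ i" "B $ i $ j = B $ j $ i" for i j
    using A Bsym by (auto simp: matrices_of_graph_def transpose_def vec_eq_iff)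
  then have "transpose ?M = ?M"
    by (auto simp: transpose_def vec_eq_iff reflection_matrix_def split: sum.split)
  \<comment> \<open>\<open>A\<close> and \<open>- A\<close> have the same zero pattern, and the full
    blocks \<open>B\<close> match the arcs between the two copies.\<close>
  then have M: "?M \<in> matrices_of_graph (graph_join G G)"
    using A Bnz assms(2)
    by (auto simp: matrices_of_graph_def graph_join_def reflection_matrix_def split: sum.split)
  \<comment> \<open>The two copies of any vertex are adjacent in the join, which supplies the
    nonzero off-diagonal entry for both the upper and the lower bound.\<close>
  fix v :: 'v
  have "q_matrix ?M = 2"
    by (rule q_matrix_involution[OF reflection_matrix_involution[OF AB], of "Inl v" "Inr v"])
      (simp_all add: reflection_matrix_def Bnz)
  with M have mem: "2 \<in> q_matrix ` matrices_of_graph (graph_join G G)" by force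
  have low: "2 \<le> q_matrix N" if "N \<in> matrices_of_graph (graph_join G G)" for N
  proof (rule two_eigenvalues_symmetric)
    show "transpose N = N" using that by (simp add: matrices_of_graph_def)
    show "N $ Inl v $ Inr v \<noteq> 0"
      using that assms(2) by (simp add: matrices_of_graph_def graph_join_def)
  qed simp
  show ?thesis
    unfolding q_graph_def by (rule cInf_eq_minimum[OF mem]) (use low in blast)
qed

end
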